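(* If a $(v,k,\lambda)$-BIBD with replication number $r=\frac{\lambda(v-1)}{k-1}$ admits a $0$-ULSE $\ell$-colouring, then $\frac{r}{\ell-1}\in\mathbb{Z}$.
   Context: For positive integers $v,k,\lambda$ with $2\le k<v$, a $(v,k,\lambda)$-BIBD is a pair $(V,\mathcal{B})$ where $V$ is a set of $v$ points and $\mathcal{B}$ is a collection of $k$-element subsets of $V$ (blocks) such that every pair of distinct points lies in exactly $\lambda$ blocks; each point lies in exactly $r=\lambda(v-1)/(k-1)$ blocks. An $\ell$-colouring is a surjective map from $V$ onto a set of $\ell$ colours. A $0$-ULSE $\ell$-colouring is an $\ell$-colouring such that $(\ell-1)$ divides $k$ and in every block exactly one colour does not appear, while each of the other $\ell-1$ colours appears exactly $\frac{k}{\ell-1}$ times in that block. *)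

theory Defs
  imports Complex_Main "HOL-Library.Multiset"
begin

text \<open>The blocks form a multiset, so a design may have repeated blocks;
  a block occurring several times contributes its multiplicity to \<open>\<lambda>\<close>.\<close>

definition bibd :: "'a set \<Rightarrow> 'a set multiset \<Rightarrow> nat \<Rightarrow> nat \<Rightarrow> nat \<Rightarrow> bool" where
  "bibd V \<B> v k \<Lambda> \<longleftrightarrow>
     2 \<le> k \<and> k < v \<and> 0 < \<Lambda> \<and>
     finite V \<and> card V = v \<and>
     (\<forall>B \<in># \<B>. B \<subseteq> V \<and> card B = k) \<and>
     (\<forall>x\<in>V. \<forall>y\<in>V. x \<noteq> y \<longrightarrow> size {#B \<in># \<B>. x \<in> B \<and> y \<in> B#} = \<Lambda>)"

definition colouring :: "'a set \<Rightarrow> nat \<Rightarrow> 'c set \<Rightarrow> ('a \<Rightarrow> 'c) \<Rightarrow> bool" where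
  "colouring V l C f \<longleftrightarrow> finite C \<and> card C = l \<and> f ` V = C"

text \<open>The natural-number operations \<open>l - 1\<close> and \<open>k div (l - 1)\<close> are exact here: a colouring of a
  nonempty point set has \<open>l \<ge> 1\<close>, and \<open>l - 1\<close> divides \<open>k\<close> (which rules out \<open>l = 1\<close> for \<open>k > 0\<close>).\<close>

definition ulse0_colouring ::
  "'a set \<Rightarrow> 'a set multiset \<Rightarrow> nat \<Rightarrow> nat \<Rightarrow> 'c set \<Rightarrow> ('a \<Rightarrow> 'c) \<Rightarrow> bool" where
  "ulse0_colouring V \<B> k l C f \<longleftrightarrow>
     colouring V l C f \<and> (l - 1) dvd k \<and>
     (\<forall>B \<in># \<B>. \<exists>!c. c \<in> C \<and> c \<notin> f ` B) \<and>
     (\<forall>B \<in># \<B>. \<forall>d \<in> C. d \<in> f ` B \<longrightarrow> card {x \<in> B. f x = d} = k div (l - 1))"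

end

theory Submission
  imports Defs
begin

text \<open>Fix a point \<open>x\<close> of colour \<open>c\<close> and put \<open>n = k / (l - 1)\<close>. Counting the points of colour \<open>c\<close>
  other than \<open>x\<close> in the blocks through \<open>x\<close> gives \<open>\<Lambda> (s - 1) = r (n - 1)\<close> for the size \<open>s\<close> of the
  colour class, so all colour classes have the same size. For a colour \<open>d \<noteq> c\<close> missed by \<open>a\<close> of the
  blocks through \<open>x\<close>, the same count gives \<open>\<Lambda> s = n (r - a)\<close>, so \<open>a\<close> does not depend on \<open>d\<close>. Every
  block through \<open>x\<close> misses exactly one of the \<open>l - 1\<close> colours other than \<open>c\<close>, hence
  \<open>r = (l - 1) a\<close>.\<close>

text \<open>Double counting of the pairs \<open>(y, B)\<close> with \<open>P y B\<close>. The
  induction on \<open>M\<close> counts repeated blocks with their multiplicity.\<close>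

lemma sum_size_filter_mset:
  assumes "finite S"
  shows "(\<Sum>y\<in>S. size {#B \<in># M. P y B#}) = (\<Sum>B\<in>#M. card {y \<in> S. P y B})"
proof (induction M)
  case (add B M)
  have "(\<Sum>y\<in>S. size {#B \<in># add_mset B M. P y B#})
      = (\<Sum>y\<in>S. (if P y B then 1 else 0) + size {#B \<in># M. P y B#})"
    by (intro sum.cong) auto
  also have "\<dots> = card {y \<in> S. P y B} + (\<Sum>y\<in>S. size {#B \<in># M. P y B#})"
    using assms by (simp add: sum.distrib flip: sum.inter_filter)
  finally show ?case
    using add.IH by simp
qed simp

lemma sum_mset_const:
  fixes q :: nat
  assumes "\<And>B. B \<in># M \<Longrightarrow> g B = q"
  shows "(\<Sum>B\<in>#M. g B) = size M * q"
  using assms by (induction M) auto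

lemma sum_mset_if:
  fixes q :: nat
  shows "(\<Sum>B\<in>#M. if P B then q else 0) = size {#B \<in># M. P B#} * q"
  by (induction M) auto

definition blocks_through :: "'a \<Rightarrow> 'a set multiset \<Rightarrow> 'a set multiset" where
  "blocks_through x \<B> = {#B \<in># \<B>. x \<in> B#}"

lemma in_blocks_through_iff [simp]: "B \<in># blocks_through x \<B> \<longleftrightarrow> B \<in># \<B> \<and> x \<in> B"
  by (simp add: blocks_through_def)

text \<open>Each \<open>y\<close> in \<open>S\<close> differs from \<open>x\<close>, so exactly
  \<open>\<Lambda>\<close> blocks contain both; now exchange the order of counting. All later counts
  are instances with different \<open>S\<close>.\<close>

lemma bibd_count_through:
  assumes "bibd V \<B> v k \<Lambda>" "x \<in> V" "S \<subseteq> V - {x}"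
  shows "(\<Sum>B\<in>#blocks_through x \<B>. card {y \<in> S. y \<in> B}) = card S * \<Lambda>"
proof -
  have "finite S"
    using assms by (auto simp: bibd_def intro: finite_subset)
  have "size {#B \<in># blocks_through x \<B>. y \<in> B#} = \<Lambda>" if "y \<in> S" for y
  proof -
    have "y \<in> V" "x \<noteq> y"
      using assms(3) that by auto
    then have "size {#B \<in># \<B>. x \<in> B \<and> y \<in> B#} = \<Lambda>"
      using assms(1,2) by (simp add: bibd_def)
    then show ?thesis
      by (simp add: blocks_through_def filter_filter_mset conj_commute)
  qed
  then show ?thesis
    using sum_size_filter_mset[OF \<open>finite S\<close>, of "\<lambda>y B. y \<in> B" "blocks_through x \<B>"] by simp
qed

lemma bibd_replication:
  assumes "bibd V \<B> v k \<Lambda>" "x \<in> V"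
  shows "size (blocks_through x \<B>) * (k - 1) = (v - 1) * \<Lambda>"
proof -
  have "card {y \<in> V - {x}. y \<in> B} = k - 1" if "B \<in># blocks_through x \<B>" for B
  proof -
    have "{y \<in> V - {x}. y \<in> B} = B - {x}" "card B = k" "x \<in> B"
      using assms that by (auto simp: bibd_def)
    then show ?thesis
      by simp
  qed
  then have "(\<Sum>B\<in>#blocks_through x \<B>. card {y \<in> V - {x}. y \<in> B})
      = size (blocks_through x \<B>) * (k - 1)"
    by (rule sum_mset_const)
  moreover have "card (V - {x}) = v - 1"
    using assms by (auto simp: bibd_def)
  ultimately show ?thesis
    using bibd_count_through[OF assms, of "V - {x}"] by simp
qed

text \<open>A block through \<open>x\<close> cannot miss the colour \<open>f x\<close>, so it has
  \<open>k div (l - 1) - 1\<close> points of that colour besides \<open>x\<close>. Adding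
  \<open>\<Lambda>\<close> on the right accounts for \<open>x\<close> itself.\<close>

lemma ulse0_own_colour_class:
  assumes "bibd V \<B> v k \<Lambda>" "ulse0_colouring V \<B> k l C f" "x \<in> V"
  shows "card {y \<in> V. f y = f x} * \<Lambda>
    = size (blocks_through x \<B>) * (k div (l - 1) - 1) + \<Lambda>"
proof -
  let ?S = "{y \<in> V. f y = f x}"
  have fin: "finite ?S"
    using assms(1) by (simp add: bibd_def)
  have "card {y \<in> ?S - {x}. y \<in> B} = k div (l - 1) - 1" if "B \<in># blocks_through x \<B>" for B
  proof -
    have "B \<subseteq> V" "B \<in># \<B>" "x \<in> B"
      using assms(1) that by (auto simp: bibd_def)
    then have "{y \<in> ?S - {x}. y \<in> B} = {y \<in> B. f y = f x} - {x}"
      by auto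
    moreover have "card {y \<in> B. f y = f x} = k div (l - 1)"
      using assms(2,3) \<open>B \<in># \<B>\<close> \<open>x \<in> B\<close> by (auto simp: ulse0_colouring_def colouring_def)
    ultimately show ?thesis
      using \<open>x \<in> B\<close> by simp
  qed
  then have "(\<Sum>B\<in>#blocks_through x \<B>. card {y \<in> ?S - {x}. y \<in> B})
      = size (blocks_through x \<B>) * (k div (l - 1) - 1)"
    by (rule sum_mset_const)
  moreover have "(\<Sum>B\<in>#blocks_through x \<B>. card {y \<in> ?S - {x}. y \<in> B}) = card (?S - {x}) * \<Lambda>"
    by (rule bibd_count_through[OF assms(1,3)]) auto
  moreover have "card ?S = Suc (card (?S - {x}))"
    using fin assms(3) by (intro card.remove) auto
  ultimately show ?thesis
    by simp
qed

text \<open>Here \<open>x\<close> lies outside the class, so no point has to be removed, but blocks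
  through \<open>x\<close> that miss \<open>d\<close> contribute nothing.\<close>

lemma ulse0_other_colour_class:
  assumes "bibd V \<B> v k \<Lambda>" "ulse0_colouring V \<B> k l C f" "x \<in> V" "d \<in> C" "d \<noteq> f x"
  shows "card {y \<in> V. f y = d} * \<Lambda>
    = size {#B \<in># blocks_through x \<B>. d \<in> f ` B#} * (k div (l - 1))"
proof -
  let ?N = "blocks_through x \<B>" and ?S = "{y \<in> V. f y = d}"
  have "card {y \<in> ?S. y \<in> B} = (if d \<in> f ` B then k div (l - 1) else 0)" if "B \<in># ?N" for B
  proof -
    have "B \<subseteq> V" "B \<in># \<B>"
      using assms(1) that by (auto simp: bibd_def)
    then have eq: "{y \<in> ?S. y \<in> B} = {y \<in> B. f y = d}"
      by auto
    have "card {y \<in> B. f y = d} = k div (l - 1)" if "d \<in> f ` B"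
      using assms(2,4) \<open>B \<in># \<B>\<close> that by (simp add: ulse0_colouring_def)
    moreover have "{y \<in> B. f y = d} = {}" if "d \<notin> f ` B"
      using that by auto
    ultimately show ?thesis
      unfolding eq
      by (cases "d \<in> f ` B") (simp_all only: if_True if_False card.empty not_False_eq_True)
  qed
  then have "(\<Sum>B\<in>#?N. card {y \<in> ?S. y \<in> B})
      = (\<Sum>B\<in>#?N. if d \<in> f ` B then k div (l - 1) else 0)"
    by (intro arg_cong[where f = sum_mset] image_mset_cong) auto
  also have "\<dots> = size {#B \<in># ?N. d \<in> f ` B#} * (k div (l - 1))"
    by (rule sum_mset_if)
  finally have "(\<Sum>B\<in>#?N. card {y \<in> ?S. y \<in> B})
      = size {#B \<in># ?N. d \<in> f ` B#} * (k div (l - 1))" .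
  moreover have "?S \<subseteq> V - {x}"
    using assms(5) by auto
  ultimately show ?thesis
    using bibd_count_through[OF assms(1,3), of ?S] by simp
qed

text \<open>Double counting of blocks through \<open>x\<close> against their missing colours: each
  block misses exactly one, and never \<open>f x\<close>, since it contains
  \<open>x\<close>.\<close>

lemma ulse0_missing_colours:
  assumes "ulse0_colouring V \<B> k l C f" "x \<in> V"
  shows "(\<Sum>d\<in>C - {f x}. size {#B \<in># blocks_through x \<B>. d \<notin> f ` B#})
    = size (blocks_through x \<B>)"
proof -
  let ?N = "blocks_through x \<B>"
  have "card {d \<in> C - {f x}. d \<notin> f ` B} = 1" if "B \<in># ?N" for B
  proof -
    have "B \<in># \<B>" "x \<in> B"
      using that by auto
    then obtain c where "\<And>d. d \<in> C \<and> d \<notin> f ` B \<longleftrightarrow> d = c"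
      using assms(1) unfolding ulse0_colouring_def by metis
    then have "{d \<in> C - {f x}. d \<notin> f ` B} = {c}"
      using \<open>x \<in> B\<close> by blast
    then show ?thesis
      by simp
  qed
  then have "(\<Sum>B\<in>#?N. card {d \<in> C - {f x}. d \<notin> f ` B}) = size ?N * 1"
    by (rule sum_mset_const)
  moreover have "finite (C - {f x})"
    using assms(1) by (simp add: ulse0_colouring_def colouring_def)
  ultimately show ?thesis
    using sum_size_filter_mset[of "C - {f x}" "\<lambda>d B. d \<notin> f ` B" ?N] by simp
qed

lemma ulse0_dvd_replication:
  assumes "bibd V \<B> v k \<Lambda>" "ulse0_colouring V \<B> k l C f" "x \<in> V"
  shows "(l - 1) dvd size (blocks_through x \<B>)"
proof -
  let ?N = "blocks_through x \<B>" and ?n = "k div (l - 1)"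
  let ?miss = "\<lambda>d. size {#B \<in># ?N. d \<notin> f ` B#}" and ?meet = "\<lambda>d. size {#B \<in># ?N. d \<in> f ` B#}"
  have k: "2 \<le> k" "k < v" "0 < \<Lambda>"
    using assms(1) by (auto simp: bibd_def)
  \<comment> \<open>This lets class sizes computed at points of other colours be compared with
    counts at \<open>x\<close>.\<close>
  have rep: "size (blocks_through y \<B>) = size ?N" if "y \<in> V" for y
  proof -
    have "size (blocks_through y \<B>) * (k - 1) = size ?N * (k - 1)"
      using bibd_replication[OF assms(1)] that assms(3) by simp
    then show ?thesis
      using k by simp
  qed
  have C: "f ` V = C" "finite C" "card C = l" and dvd: "(l - 1) dvd k"
    using assms(2) by (auto simp: ulse0_colouring_def colouring_def)
  \<comment> \<open>The case \<open>l - 1 = 0\<close> is covered too: \<open>0 dvd k\<close> would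
    force \<open>k = 0\<close>.\<close>
  have "?n > 0"
    using dvd k by (metis dvd_div_eq_0_iff gr0I not_numeral_le_zero)
  have miss: "?miss d = ?miss d'" if d: "d \<in> C - {f x}" "d' \<in> C - {f x}" for d d'
  proof -
    \<comment> \<open>The right side is free of \<open>e\<close>, so all colour classes have equal
      size; surjectivity supplies a base point of colour \<open>e\<close>.\<close>
    have size: "card {y \<in> V. f y = e} * \<Lambda> = size ?N * (?n - 1) + \<Lambda>" if e: "e \<in> C" for e
    proof -
      obtain y where "y \<in> V" "f y = e"
        using C(1) e by auto
      then show ?thesis
        using ulse0_own_colour_class[OF assms(1,2), of y] rep[of y] by simp
    qed
    have "?meet d * ?n = ?meet d' * ?n"
      using ulse0_other_colour_class[OF assms, of d] ulse0_other_colour_class[OF assms, of d']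
        size[of d] size[of d'] d by (metis DiffE singletonI)
    then have "?meet d = ?meet d'"
      using \<open>?n > 0\<close> by simp
    \<comment> \<open>Equal numbers of meeting blocks thus give equal numbers of missing
      blocks.\<close>
    moreover have "size ?N = ?meet e + ?miss e" for e
      by (metis multiset_partition size_union)
    ultimately show ?thesis
      by (metis add_left_cancel)
  qed
  have card: "card (C - {f x}) = l - 1"
    using C assms(3) by auto
  show ?thesis
  proof (cases "C - {f x} = {}")
    case True
    then have "l - 1 = 0"
      using card by (metis card.empty)
    then show ?thesis
      using dvd k by simp
  next
    case False
    then obtain d where "d \<in> C - {f x}"
      by blast
    \<comment> \<open>The sum becomes \<open>(l - 1) * ?miss d\<close>, while it also equals
      \<open>size ?N\<close>.\<close>
    then have "(\<Sum>e\<in>C - {f x}. ?miss e) = (\<Sum>e\<in>C - {f x}. ?miss d)"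
      by (intro sum.cong refl miss)
    then show ?thesis
      using ulse0_missing_colours[OF assms(2,3)] card by simp
  qed
qed

theorem theorem3p9:
  fixes V :: "'a set" and \<B> :: "'a set multiset" and v k \<Lambda> l :: nat and r :: real
  assumes "bibd V \<B> v k \<Lambda>"
    and "r = real \<Lambda> * (real v - 1) / (real k - 1)"
    and "\<exists>(C :: 'c set) f. ulse0_colouring V \<B> k l C f"
  shows "r / (real l - 1) \<in> \<int>"
proof -
  obtain C :: "'c set" and f where col: "ulse0_colouring V \<B> k l C f"
    using assms(3) by blast
  have k: "2 \<le> k" "k < v" and V: "card V = v" "finite V"
    using assms(1) by (auto simp: bibd_def)
  then obtain x where x: "x \<in> V"
    by fastforce
  let ?R = "size (blocks_through x \<B>)"
  have "real ?R * (real k - 1) = real \<Lambda> * (real v - 1)"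
    using arg_cong[OF bibd_replication[OF assms(1) x], of real] k
    by (simp add: mult.commute of_nat_diff)
  then have r: "r = real ?R"
    unfolding assms(2) using k by (subst eq_commute) (simp add: nonzero_eq_divide_eq)
  \<comment> \<open>Excluding \<open>l = 0\<close> makes the truncated \<open>l - 1\<close> agree
    with real subtraction; excluding \<open>l = 1\<close> makes the divisor nonzero.\<close>
  have "l \<noteq> 0"
    using col x by (metis card_0_eq colouring_def empty_iff image_is_empty ulse0_colouring_def)
  moreover have "l \<noteq> 1"
    using col k by (auto simp: ulse0_colouring_def)
  ultimately have l: "real (l - 1) = real l - 1" "real l - 1 \<noteq> 0"
    by (auto simp: of_nat_diff)
  obtain a where "?R = (l - 1) * a"
    using ulse0_dvd_replication[OF assms(1) col x] by (elim dvdE)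
  then have "r = (real l - 1) * real a"
    unfolding r by (simp only: of_nat_mult l(1))
  then have "r / (real l - 1) = real a"
    using l(2) by simp
  then show ?thesis
    by simp
qed

end
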